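(* There exist a complex Hilbert space $H$, an operator $T\in\mathcal{B}(H)$ with $\sigma(T)\subset\overline{\mathbb{D}}$, a number $\nu>0$ and a continuous function $\varepsilon:(0,\nu)\to[0,\infty)$ with $\lim_{x\to0^+}\varepsilon(x)=0$ such that $$\|(\lambda-T)^{-1}\|\le\frac{1+\varepsilon(|\lambda|-1)}{|\lambda|-1}\quad\text{for all }1<|\lambda|<1+\nu,$$ and $T$ is not power bounded.
   Context: $\overline{\mathbb{D}}$ is the closed unit disk. $T$ is power bounded if $\sup_{n\ge1}\|T^n\|<\infty$. *)

theory Defs
  imports "HOL-Analysis.Analysis" "HOL-Algebra.Module" "HOL-Algebra.Algebraic_Closure_Type"
begin

text \<open>
  A complex Hilbert space is a carrier-based structure, so that a theorem can assert the
  existence of one. The ring component of \<^type>\<open>module\<close> supplies the additive group; its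
  multiplicative fields carry no meaning, as for every module in HOL-Algebra.
\<close>

record 'a hilbert = "(complex, 'a) module" +
  cinner :: "'a \<Rightarrow> 'a \<Rightarrow> complex"

definition hnorm :: "'a hilbert \<Rightarrow> 'a \<Rightarrow> real" where
  "hnorm H x = sqrt (Re (cinner H x x))"

text \<open>
  The inner product is linear in the first argument. That \<open>cinner H x x\<close> is real follows from
  conjugate symmetry. Completeness is written out because \<^locale>\<open>Metric_space\<close> would also
  constrain the distance off the carrier.
\<close>

locale complex_hilbert_space =
  module "ring_of_type_algebra :: complex ring" H for H :: "'a hilbert" (structure) +
  assumes cinner_commute:
      "\<lbrakk>x \<in> carrier H; y \<in> carrier H\<rbrakk> \<Longrightarrow> cinner H x y = cnj (cinner H y x)"
    and cinner_add_left:
      "\<lbrakk>x \<in> carrier H; y \<in> carrier H; z \<in> carrier H\<rbrakk>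
        \<Longrightarrow> cinner H (x \<oplus>\<^bsub>H\<^esub> y) z = cinner H x z + cinner H y z"
    and cinner_smult_left:
      "\<lbrakk>x \<in> carrier H; y \<in> carrier H\<rbrakk> \<Longrightarrow> cinner H (c \<odot>\<^bsub>H\<^esub> x) y = c * cinner H x y"
    and cinner_ge_zero: "x \<in> carrier H \<Longrightarrow> 0 \<le> Re (cinner H x x)"
    and cinner_eq_zeroD: "\<lbrakk>x \<in> carrier H; cinner H x x = 0\<rbrakk> \<Longrightarrow> x = \<zero>\<^bsub>H\<^esub>"
    and complete:
      "\<lbrakk>\<And>n. s n \<in> carrier H;
        \<And>e. e > 0 \<Longrightarrow> \<exists>N. \<forall>m\<ge>N. \<forall>n\<ge>N. hnorm H (s m \<ominus>\<^bsub>H\<^esub> s n) < e\<rbrakk>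
        \<Longrightarrow> \<exists>x\<in>carrier H. (\<lambda>n. hnorm H (s n \<ominus>\<^bsub>H\<^esub> x)) \<longlonglongrightarrow> 0"

text \<open>Operators are functions on the whole type of which only the values on the carrier matter.\<close>

definition bounded_operator :: "'a hilbert \<Rightarrow> ('a \<Rightarrow> 'a) \<Rightarrow> bool" where
  "bounded_operator H T \<longleftrightarrow>
     T \<in> carrier H \<rightarrow> carrier H \<and>
     (\<forall>x\<in>carrier H. \<forall>y\<in>carrier H. T (x \<oplus>\<^bsub>H\<^esub> y) = T x \<oplus>\<^bsub>H\<^esub> T y) \<and>
     (\<forall>c. \<forall>x\<in>carrier H. T (c \<odot>\<^bsub>H\<^esub> x) = c \<odot>\<^bsub>H\<^esub> T x) \<and>
     (\<exists>K. \<forall>x\<in>carrier H. hnorm H (T x) \<le> K * hnorm H x)"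

text \<open>Meaningful for bounded operators only: the supremum is taken in \<^typ>\<open>real\<close>.\<close>

definition opnorm :: "'a hilbert \<Rightarrow> ('a \<Rightarrow> 'a) \<Rightarrow> real" where
  "opnorm H T = (SUP x\<in>{x \<in> carrier H. hnorm H x \<le> 1}. hnorm H (T x))"

definition shifted :: "'a hilbert \<Rightarrow> ('a \<Rightarrow> 'a) \<Rightarrow> complex \<Rightarrow> 'a \<Rightarrow> 'a" where
  "shifted H T z = (\<lambda>x. z \<odot>\<^bsub>H\<^esub> x \<ominus>\<^bsub>H\<^esub> T x)"

definition invertible_operator :: "'a hilbert \<Rightarrow> ('a \<Rightarrow> 'a) \<Rightarrow> bool" where
  "invertible_operator H A \<longleftrightarrow>
     (\<exists>B. bounded_operator H B \<and> (\<forall>x\<in>carrier H. B (A x) = x \<and> A (B x) = x))"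

definition spectrum :: "'a hilbert \<Rightarrow> ('a \<Rightarrow> 'a) \<Rightarrow> complex set" where
  "spectrum H T = {z. \<not> invertible_operator H (shifted H T z)}"

text \<open>Off the spectrum this is, on the carrier, the inverse of \<open>z - T\<close>.\<close>

definition resolvent :: "'a hilbert \<Rightarrow> ('a \<Rightarrow> 'a) \<Rightarrow> complex \<Rightarrow> 'a \<Rightarrow> 'a" where
  "resolvent H T z = inv_into (carrier H) (shifted H T z)"

definition power_bounded :: "'a hilbert \<Rightarrow> ('a \<Rightarrow> 'a) \<Rightarrow> bool" where
  "power_bounded H T \<longleftrightarrow> bdd_above ((\<lambda>n. opnorm H (T ^^ n)) ` {1..})"

end

theory Submission
  imports Defs
begin

text \<open>
  The operator is the weighted shift \<open>T e\<^sub>k = w\<^sub>k e\<^sub>k\<^sub>+\<^sub>1\<close> on \<open>\<ell>\<^sup>2\<close> with \<open>w\<^sub>k\<^sup>2 = L(k+1) / L(k)\<close> and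
  \<open>L(k) = 4 + ln (k + 2)\<close>. The squared weights telescope, so \<open>\<parallel>T\<^sup>n e\<^sub>0\<parallel>\<^sup>2 = L(n) / L(0)\<close> and the powers
  are unbounded. The growth is only logarithmic, and this makes it invisible to the resolvent in
  the limit: with \<open>r = |z| - 1\<close>, the resolvent lives on indices of size about \<open>1/r\<close>, and there
  \<open>w\<^sub>k\<^sup>2 - 1\<close> is at most \<open>1 / (k ln k)\<close>, small compared with \<open>r\<close> by a factor \<open>1 / ln (1/r)\<close>.

  To make this precise, let \<open>g = (z - T) y\<close>, so that \<open>g\<^sub>k\<^sub>+\<^sub>1 = z y\<^sub>k\<^sub>+\<^sub>1 - w\<^sub>k y\<^sub>k\<close>. A lower bound
  \<open>\<Sum>|g\<^sub>k|\<^sup>2 \<ge> s\<^sup>2 \<Sum>|y\<^sub>k|\<^sup>2\<close> follows by summation from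
  \<open>|g\<^sub>k\<^sub>+\<^sub>1|\<^sup>2 \<ge> s\<^sup>2 |y\<^sub>k\<^sub>+\<^sub>1|\<^sup>2 + p\<^sub>k\<^sub>+\<^sub>1 |y\<^sub>k\<^sub>+\<^sub>1|\<^sup>2 - p\<^sub>k |y\<^sub>k|\<^sup>2\<close>, provided that \<open>p\<close> is nonnegative and
  \<open>s\<^sup>2 + p\<^sub>0 \<le> |z|\<^sup>2\<close>. For given \<open>p\<close> this is the nonnegativity of a binary quadratic form, that is, a Riccati inequality between
  \<open>p\<^sub>k\<close> and \<open>p\<^sub>k\<^sub>+\<^sub>1\<close> (\<open>riccati_energy\<close>). For the unweighted shift and \<open>s = r\<close>, the recursion has the
  single fixed point \<open>p = r\<close>. Here \<open>p\<^sub>k = r + 1 / (2 (k + 1))\<close> works with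
  \<open>s\<^sup>2 = r\<^sup>2 (1 - \<epsilon>(r))\<close>: the correction to \<open>r\<close> gains a term \<open>1 / (4 n\<^sup>2)\<close>, \<open>n = k + 2\<close>, as in
  Hardy's inequality. This gain and \<open>\<epsilon>(r) r\<^sup>2\<close> dominate the loss \<open>r / (n L(k))\<close> that the weights
  cause, the gain alone for \<open>n r \<le> 1/2\<close> and both together, by the inequality between the
  arithmetic and geometric means, for \<open>n r > 1/2\<close> (\<open>drift_le_excess\<close>, \<open>log_shift_riccati\<close>).

  The estimate holds for finite sections of an arbitrary sequence. Hence the formal solution of
  \<open>(z - T) y = g\<close>, which forward substitution provides, lies in \<open>\<ell>\<^sup>2\<close> whenever \<open>g\<close> does, and the
  same estimate gives invertibility and the resolvent bound (\<open>weighted_shift_resolvent\<close>).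
\<close>

section \<open>The Hilbert space of square-summable sequences\<close>

definition ell2 :: "(nat \<Rightarrow> complex) hilbert" where
  "ell2 = \<lparr>carrier = {x. summable (\<lambda>n. (cmod (x n))\<^sup>2)},
           monoid.mult = (\<lambda>x y. x), one = (\<lambda>n. 0),
           ring.zero = (\<lambda>n. 0), add = (\<lambda>x y n. x n + y n),
           smult = (\<lambda>c x n. c * x n),
           cinner = (\<lambda>x y. \<Sum>n. x n * cnj (y n))\<rparr>"

lemma ell2_simps:
  "x \<in> carrier ell2 \<longleftrightarrow> summable (\<lambda>n. (cmod (x n))\<^sup>2)"
  "\<zero>\<^bsub>ell2\<^esub> = (\<lambda>n. 0)"
  "x \<oplus>\<^bsub>ell2\<^esub> y = (\<lambda>n. x n + y n)"
  "c \<odot>\<^bsub>ell2\<^esub> x = (\<lambda>n. c * x n)"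
  "cinner ell2 x y = (\<Sum>n. x n * cnj (y n))"
  by (simp_all add: ell2_def)

lemma ell2_add_closed:
  assumes "x \<in> carrier ell2" "y \<in> carrier ell2"
  shows "(\<lambda>n. x n + y n) \<in> carrier ell2"
proof -
  have "summable (\<lambda>n. 2 * (cmod (x n))\<^sup>2 + 2 * (cmod (y n))\<^sup>2)"
    using assms by (intro summable_add summable_mult) (simp_all add: ell2_simps)
  moreover have "(cmod (x n + y n))\<^sup>2 \<le> 2 * (cmod (x n))\<^sup>2 + 2 * (cmod (y n))\<^sup>2" for n
  proof -
    have "(cmod (x n + y n))\<^sup>2 \<le> (cmod (x n) + cmod (y n))\<^sup>2"
      by (intro power_mono norm_triangle_ineq) auto
    also have "\<dots> \<le> 2 * (cmod (x n))\<^sup>2 + 2 * (cmod (y n))\<^sup>2"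
      using sum_squares_bound[of "cmod (x n)" "cmod (y n)"] by (simp add: power2_sum)
    finally show ?thesis .
  qed
  ultimately show ?thesis
    unfolding ell2_simps(1)
    by (elim summable_comparison_test'[where N = 0]) simp
qed

lemma ell2_scale_closed:
  assumes "x \<in> carrier ell2"
  shows "(\<lambda>n. c * x n) \<in> carrier ell2"
  using assms summable_mult[of "\<lambda>n. (cmod (x n))\<^sup>2" "(cmod c)\<^sup>2"]
  by (simp add: ell2_simps norm_mult power_mult_distrib)

lemma ell2_zero_closed: "(\<lambda>n. 0) \<in> carrier ell2"
  by (simp add: ell2_simps)

lemma ell2_inner_summable:
  assumes "x \<in> carrier ell2" "y \<in> carrier ell2"
  shows "summable (\<lambda>n. x n * cnj (y n))"
proof (rule summable_norm_cancel, rule summable_comparison_test'[where N = 0])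
  show "summable (\<lambda>n. (cmod (x n))\<^sup>2 + (cmod (y n))\<^sup>2)"
    using assms by (intro summable_add) (simp_all add: ell2_simps)
  show "norm (norm (x n * cnj (y n))) \<le> (cmod (x n))\<^sup>2 + (cmod (y n))\<^sup>2" for n
  proof -
    have "2 * (cmod (x n) * cmod (y n)) \<le> (cmod (x n))\<^sup>2 + (cmod (y n))\<^sup>2"
      using sum_squares_bound[of "cmod (x n)" "cmod (y n)"] by (simp only: mult.assoc)
    moreover have "0 \<le> cmod (x n) * cmod (y n)" by simp
    ultimately have "cmod (x n) * cmod (y n) \<le> (cmod (x n))\<^sup>2 + (cmod (y n))\<^sup>2"
      by linarith
    then show ?thesis by (simp add: norm_mult)
  qed
qed

lemma ell2_cinner_self:
  assumes "x \<in> carrier ell2"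
  shows "cinner ell2 x x = of_real (\<Sum>n. (cmod (x n))\<^sup>2)"
  using assms by (simp add: ell2_simps complex_norm_square[symmetric] suminf_of_real)

lemma hnorm_ell2:
  assumes "x \<in> carrier ell2"
  shows "hnorm ell2 x = sqrt (\<Sum>n. (cmod (x n))\<^sup>2)"
  using assms by (simp add: hnorm_def ell2_cinner_self)

lemma hnorm_ell2_sq:
  assumes "x \<in> carrier ell2"
  shows "(hnorm ell2 x)\<^sup>2 = (\<Sum>n. (cmod (x n))\<^sup>2)"
  using assms by (simp add: hnorm_ell2 ell2_simps suminf_nonneg)

lemma hnorm_ell2_nonneg:
  assumes "x \<in> carrier ell2"
  shows "hnorm ell2 x \<ge> 0"
  using assms by (simp add: hnorm_ell2 ell2_simps(1) suminf_nonneg)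

lemma partial_sum_le_hnorm_sq:
  assumes "x \<in> carrier ell2"
  shows "(\<Sum>k\<le>N. (cmod (x k))\<^sup>2) \<le> (hnorm ell2 x)\<^sup>2"
  using assms unfolding hnorm_ell2_sq[OF assms]
  by (intro sum_le_suminf) (auto simp: ell2_simps)

text \<open>The form in which estimates on finite sections enter: they yield membership and the norm
  bound at once.\<close>

lemma ell2_bounded_partial_sums:
  assumes "C \<ge> 0" and "\<And>N. (\<Sum>k\<le>N. (cmod (x k))\<^sup>2) \<le> C\<^sup>2"
  shows "x \<in> carrier ell2" and "hnorm ell2 x \<le> C"
proof -
  have lt: "(\<Sum>k<N. (cmod (x k))\<^sup>2) \<le> C\<^sup>2" for N
  proof -
    have "(\<Sum>k<N. (cmod (x k))\<^sup>2) \<le> (\<Sum>k\<le>N. (cmod (x k))\<^sup>2)"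
      by (intro sum_mono2) auto
    then show ?thesis using assms(2)[of N] by linarith
  qed
  have s: "summable (\<lambda>n. (cmod (x n))\<^sup>2)"
    by (rule summableI_nonneg_bounded[OF _ lt]) auto
  then show x: "x \<in> carrier ell2" by (simp add: ell2_simps)
  have "(\<Sum>n. (cmod (x n))\<^sup>2) \<le> C\<^sup>2"
    by (rule suminf_le_const[OF s lt])
  then show "hnorm ell2 x \<le> C"
    using assms(1) by (simp add: hnorm_ell2[OF x] real_le_lsqrt)
qed

lemma cring_complex: "cring (ring_of_type_algebra :: complex ring)"
  by (rule cring_from_type_algebra)

lemma abelian_group_ell2: "abelian_group ell2"
proof (rule abelian_groupI)
  fix x assume "x \<in> carrier ell2"
  then show "\<exists>y\<in>carrier ell2. y \<oplus>\<^bsub>ell2\<^esub> x = \<zero>\<^bsub>ell2\<^esub>"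
    using ell2_scale_closed[of x "-1"]
    by (intro bexI[of _ "\<lambda>n. - x n"]) (auto simp: ell2_simps(2-))
qed (auto simp: ell2_simps(2-) ell2_add_closed ell2_zero_closed add_ac)

lemma module_ell2: "module (ring_of_type_algebra :: complex ring) ell2"
  by (rule moduleI)
     (use cring_complex in \<open>auto simp: ell2_simps(2-) ell2_scale_closed abelian_group_ell2
        ring_of_type_algebra_def algebra_simps\<close>)

lemma ell2_minus:
  assumes "x \<in> carrier ell2" "y \<in> carrier ell2"
  shows "x \<ominus>\<^bsub>ell2\<^esub> y = (\<lambda>n. x n - y n)"
proof -
  interpret abelian_group ell2 by (rule abelian_group_ell2)
  have "(\<lambda>n. - y n) \<in> carrier ell2"
    using ell2_scale_closed[OF assms(2), of "-1"] by simp
  then have "\<ominus>\<^bsub>ell2\<^esub> y = (\<lambda>n. - y n)"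
    using assms by (intro minus_equality) (auto simp: ell2_simps(2-))
  then show ?thesis by (simp add: a_minus_def ell2_simps(2-))
qed

lemma ell2_diff_closed:
  assumes "x \<in> carrier ell2" "y \<in> carrier ell2"
  shows "(\<lambda>n. x n - y n) \<in> carrier ell2"
  using ell2_add_closed[OF assms(1) ell2_scale_closed[OF assms(2), of "-1"]] by simp

text \<open>The coordinatewise limit is the limit in norm, because the Cauchy bound on each finite section
  passes to the limit.\<close>

lemma ell2_complete:
  assumes mem: "\<And>n. s n \<in> carrier ell2"
    and cauchy: "\<And>e. e > 0 \<Longrightarrow> \<exists>N. \<forall>m\<ge>N. \<forall>n\<ge>N. hnorm ell2 (s m \<ominus>\<^bsub>ell2\<^esub> s n) < e"
  shows "\<exists>x\<in>carrier ell2. (\<lambda>n. hnorm ell2 (s n \<ominus>\<^bsub>ell2\<^esub> x)) \<longlonglongrightarrow> 0"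
proof -
  have part: "(\<Sum>k\<le>K. (cmod (s m k - s n k))\<^sup>2) \<le> (hnorm ell2 (s m \<ominus>\<^bsub>ell2\<^esub> s n))\<^sup>2" for m n K
    using partial_sum_le_hnorm_sq[OF ell2_diff_closed[OF mem mem]]
    by (simp add: ell2_minus mem)
  have "\<exists>l. (\<lambda>n. s n k) \<longlonglongrightarrow> l" for k
  proof -
    have "Cauchy (\<lambda>n. s n k)"
    proof (rule CauchyI)
      fix e :: real assume "e > 0"
      then obtain N where N: "\<forall>m\<ge>N. \<forall>n\<ge>N. hnorm ell2 (s m \<ominus>\<^bsub>ell2\<^esub> s n) < e"
        using cauchy by blast
      have "norm (s m k - s n k) < e" if "m \<ge> N" "n \<ge> N" for m n
      proof -
        have "(cmod (s m k - s n k))\<^sup>2 \<le> (\<Sum>j\<le>k. (cmod (s m j - s n j))\<^sup>2)"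
          by (rule member_le_sum) auto
        also note part
        also have "(hnorm ell2 (s m \<ominus>\<^bsub>ell2\<^esub> s n))\<^sup>2 < e\<^sup>2"
          using N that ell2_diff_closed[OF mem mem, of m n]
          by (intro power_strict_mono)
            (auto simp: ell2_minus mem hnorm_ell2_nonneg)
        finally show ?thesis using \<open>e > 0\<close> by (simp add: power2_less_imp_less)
      qed
      then show "\<exists>M. \<forall>m\<ge>M. \<forall>n\<ge>M. norm (s m k - s n k) < e" by blast
    qed
    then show ?thesis by (simp add: Cauchy_convergent_iff convergent_def)
  qed
  then obtain x where x: "\<And>k. (\<lambda>n. s n k) \<longlonglongrightarrow> x k" by metis
  have close: "\<exists>N. \<forall>m\<ge>N. (\<lambda>n. s m n - x n) \<in> carrier ell2 \<and> hnorm ell2 (\<lambda>n. s m n - x n) \<le> e"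
    if "e > 0" for e
  proof -
    obtain N where N: "\<forall>m\<ge>N. \<forall>n\<ge>N. hnorm ell2 (s m \<ominus>\<^bsub>ell2\<^esub> s n) < e"
      using cauchy[OF \<open>e > 0\<close>] by blast
    have "(\<Sum>k\<le>K. (cmod (s m k - x k))\<^sup>2) \<le> e\<^sup>2" if "m \<ge> N" for m K
    proof (rule LIMSEQ_le_const2)
      show "(\<lambda>n. \<Sum>k\<le>K. (cmod (s m k - s n k))\<^sup>2) \<longlonglongrightarrow> (\<Sum>k\<le>K. (cmod (s m k - x k))\<^sup>2)"
        by (intro tendsto_intros x)
      have "(\<Sum>k\<le>K. (cmod (s m k - s n k))\<^sup>2) \<le> e\<^sup>2" if "n \<ge> N" for n
      proof -
        have "(hnorm ell2 (s m \<ominus>\<^bsub>ell2\<^esub> s n))\<^sup>2 \<le> e\<^sup>2"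
          using N that \<open>m \<ge> N\<close> ell2_diff_closed[OF mem mem, of m n]
          by (intro power_mono) (auto simp: ell2_minus mem hnorm_ell2_nonneg less_imp_le)
        then show ?thesis using part[where m = m and n = n and K = K] by linarith
      qed
      then show "\<exists>N. \<forall>n\<ge>N. (\<Sum>k\<le>K. (cmod (s m k - s n k))\<^sup>2) \<le> e\<^sup>2" by blast
    qed
    then have "(\<lambda>n. s m n - x n) \<in> carrier ell2 \<and> hnorm ell2 (\<lambda>n. s m n - x n) \<le> e"
      if "m \<ge> N" for m
      using ell2_bounded_partial_sums[of e "\<lambda>n. s m n - x n"] \<open>e > 0\<close> that by simp
    then show ?thesis by blast
  qed
  obtain N where "(\<lambda>n. s N n - x n) \<in> carrier ell2" using close[of 1] by auto
  from ell2_diff_closed[OF mem this, of N] have xm: "x \<in> carrier ell2" by simp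
  have "(\<lambda>n. hnorm ell2 (s n \<ominus>\<^bsub>ell2\<^esub> x)) \<longlonglongrightarrow> 0"
  proof (rule LIMSEQ_I)
    fix e :: real assume "e > 0"
    then obtain N where N: "\<forall>m\<ge>N. hnorm ell2 (\<lambda>n. s m n - x n) \<le> e / 2"
      using close[of "e / 2"] by auto
    have "norm (hnorm ell2 (s n \<ominus>\<^bsub>ell2\<^esub> x) - 0) < e" if "n \<ge> N" for n
      using N[rule_format, OF that] \<open>e > 0\<close> ell2_diff_closed[OF mem xm, of n]
      by (simp add: ell2_minus mem xm hnorm_ell2_nonneg)
    then show "\<exists>no. \<forall>n\<ge>no. norm (hnorm ell2 (s n \<ominus>\<^bsub>ell2\<^esub> x) - 0) < e" by blast
  qed
  with xm show ?thesis by blast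
qed

lemma complex_hilbert_space_ell2: "complex_hilbert_space ell2"
proof (intro complex_hilbert_space.intro complex_hilbert_space_axioms.intro)
  show "module (ring_of_type_algebra :: complex ring) ell2" by (rule module_ell2)
next
  fix x y assume "x \<in> carrier ell2" "y \<in> carrier ell2"
  then have "(\<lambda>n. y n * cnj (x n)) sums cinner ell2 y x"
    using ell2_inner_summable[of y x] by (simp add: ell2_simps(5) summable_sums)
  then have "(\<lambda>n. cnj (y n * cnj (x n))) sums cnj (cinner ell2 y x)"
    by (simp only: sums_cnj)
  then show "cinner ell2 x y = cnj (cinner ell2 y x)"
    by (simp add: ell2_simps(5) sums_iff mult.commute)
next
  fix x y z assume "x \<in> carrier ell2" "y \<in> carrier ell2" "z \<in> carrier ell2"
  then show "cinner ell2 (x \<oplus>\<^bsub>ell2\<^esub> y) z = cinner ell2 x z + cinner ell2 y z"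
    by (simp add: ell2_simps(2-) distrib_right ell2_inner_summable suminf_add[symmetric])
next
  fix x y c assume "x \<in> carrier ell2" "y \<in> carrier ell2"
  then show "cinner ell2 (c \<odot>\<^bsub>ell2\<^esub> x) y = c * cinner ell2 x y"
    by (simp add: ell2_simps(2-) mult.assoc ell2_inner_summable suminf_mult)
next
  fix x assume "x \<in> carrier ell2"
  then show "0 \<le> Re (cinner ell2 x x)"
    by (simp add: ell2_cinner_self ell2_simps(1) suminf_nonneg)
next
  fix x assume x: "x \<in> carrier ell2" and "cinner ell2 x x = 0"
  then have "(\<Sum>n. (cmod (x n))\<^sup>2) = 0" by (simp only: ell2_cinner_self of_real_eq_0_iff)
  then have "\<forall>n. (cmod (x n))\<^sup>2 = 0"
    using x by (subst (asm) suminf_eq_zero_iff) (auto simp: ell2_simps(1))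
  then show "x = \<zero>\<^bsub>ell2\<^esub>" by (auto simp: ell2_simps(2))
next
  fix s :: "nat \<Rightarrow> nat \<Rightarrow> complex"
  assume "\<And>n. s n \<in> carrier ell2"
    "\<And>e. e > 0 \<Longrightarrow> \<exists>N. \<forall>m\<ge>N. \<forall>n\<ge>N. hnorm ell2 (s m \<ominus>\<^bsub>ell2\<^esub> s n) < e"
  then show "\<exists>x\<in>carrier ell2. (\<lambda>n. hnorm ell2 (s n \<ominus>\<^bsub>ell2\<^esub> x)) \<longlonglongrightarrow> 0"
    by (rule ell2_complete)
qed

section \<open>Weighted shifts and their resolvents\<close>

definition weighted_shift :: "(nat \<Rightarrow> real) \<Rightarrow> (nat \<Rightarrow> complex) \<Rightarrow> nat \<Rightarrow> complex" where
  "weighted_shift w x n = (case n of 0 \<Rightarrow> 0 | Suc k \<Rightarrow> of_real (w k) * x k)"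

lemma weighted_shift_simps [simp]:
  "weighted_shift w x 0 = 0"
  "weighted_shift w x (Suc k) = of_real (w k) * x k"
  by (simp_all add: weighted_shift_def)

lemma weighted_shift_bounded:
  assumes w: "\<And>k. \<bar>w k\<bar> \<le> W" and x: "x \<in> carrier ell2"
  shows "weighted_shift w x \<in> carrier ell2"
    and "hnorm ell2 (weighted_shift w x) \<le> W * hnorm ell2 x"
proof -
  have W: "W \<ge> 0" using w[of 0] by linarith
  have nn: "hnorm ell2 x \<ge> 0"
    using x by (rule hnorm_ell2_nonneg)
  have "(\<Sum>k\<le>N. (cmod (weighted_shift w x k))\<^sup>2) \<le> (W * hnorm ell2 x)\<^sup>2" for N
  proof -
    have "(\<Sum>k\<le>N. (cmod (weighted_shift w x k))\<^sup>2)
        \<le> (\<Sum>k\<le>Suc N. (cmod (weighted_shift w x k))\<^sup>2)"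
      by simp
    also have "\<dots> = (\<Sum>k\<le>N. (cmod (weighted_shift w x (Suc k)))\<^sup>2)"
      by (subst sum.atMost_Suc_shift) simp
    also have "\<dots> \<le> (\<Sum>k\<le>N. W\<^sup>2 * (cmod (x k))\<^sup>2)"
      by (intro sum_mono)
        (auto simp: norm_mult power_mult_distrib intro!: mult_right_mono abs_le_square_iff[THEN iffD1]
          order_trans[OF w])
    also have "\<dots> \<le> W\<^sup>2 * (hnorm ell2 x)\<^sup>2"
      unfolding sum_distrib_left[symmetric]
      by (intro mult_left_mono partial_sum_le_hnorm_sq x) auto
    finally show ?thesis by (simp add: power_mult_distrib)
  qed
  from ell2_bounded_partial_sums[OF _ this] W nn
  show "weighted_shift w x \<in> carrier ell2"
    and "hnorm ell2 (weighted_shift w x) \<le> W * hnorm ell2 x" by auto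
qed

lemma bounded_operator_weighted_shift:
  assumes "\<And>k. \<bar>w k\<bar> \<le> W"
  shows "bounded_operator ell2 (weighted_shift w)"
  unfolding bounded_operator_def
proof (intro conjI ballI allI)
  show "weighted_shift w \<in> carrier ell2 \<rightarrow> carrier ell2"
    using weighted_shift_bounded(1)[of w, OF assms] by auto
  show "\<exists>K. \<forall>x\<in>carrier ell2. hnorm ell2 (weighted_shift w x) \<le> K * hnorm ell2 x"
    using weighted_shift_bounded(2)[of w, OF assms] by auto
qed (auto simp: ell2_simps(2-) weighted_shift_def fun_eq_iff algebra_simps split: nat.split)

text \<open>Forward substitution for the lower triangular system \<open>(z - T) y = g\<close>, with \<open>g\<close> an arbitrary
  sequence.\<close>

primrec shift_solution :: "(nat \<Rightarrow> real) \<Rightarrow> complex \<Rightarrow> (nat \<Rightarrow> complex) \<Rightarrow> nat \<Rightarrow> complex" where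
  "shift_solution w z g 0 = g 0 / z"
| "shift_solution w z g (Suc k) = (g (Suc k) + of_real (w k) * shift_solution w z g k) / z"

lemma shift_solution_iff:
  assumes "z \<noteq> 0"
  shows "(\<forall>n. z * y n - weighted_shift w y n = g n) \<longleftrightarrow> y = shift_solution w z g"
proof
  assume *: "\<forall>n. z * y n - weighted_shift w y n = g n"
  have "y n = shift_solution w z g n" for n
  proof (induction n)
    case 0
    show ?case using *[rule_format, of 0] assms by (simp add: field_simps)
  next
    case (Suc n)
    show ?case using *[rule_format, of "Suc n"] assms Suc by (simp add: field_simps)
  qed
  then show "y = shift_solution w z g" by blast
next
  assume y: "y = shift_solution w z g"
  show "\<forall>n. z * y n - weighted_shift w y n = g n"
  proof
    fix n show "z * y n - weighted_shift w y n = g n"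
      using assms by (cases n) (simp_all add: y)
  qed
qed

text \<open>As \<open>z - T\<close> is lower triangular, it is a bijection on all sequences, and the first \<open>N\<close> entries
  of \<open>y\<close> and of \<open>(z - T) y\<close> determine each other. An estimate that is uniform in \<open>N\<close>
  therefore shows that the inverse preserves square-summability, with no separate argument
  for surjectivity.\<close>

lemma weighted_shift_resolvent:
  assumes w: "\<And>k. \<bar>w k\<bar> \<le> W" and z: "z \<noteq> 0" and C: "C \<ge> 0"
    and est: "\<And>y N. (\<Sum>k\<le>N. (cmod (y k))\<^sup>2)
      \<le> C\<^sup>2 * (\<Sum>k\<le>N. (cmod (z * y k - weighted_shift w y k))\<^sup>2)"
  shows "z \<notin> spectrum ell2 (weighted_shift w)"
    and "opnorm ell2 (resolvent ell2 (weighted_shift w) z) \<le> C"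
proof -
  let ?A = "shifted ell2 (weighted_shift w) z" and ?B = "shift_solution w z"
  have A: "?A y = (\<lambda>n. z * y n - weighted_shift w y n)" if "y \<in> carrier ell2" for y
    using that weighted_shift_bounded(1)[OF w that] ell2_scale_closed[OF that, of z]
    by (simp add: shifted_def ell2_minus ell2_simps(4))
  have AB: "(\<lambda>n. z * ?B g n - weighted_shift w (?B g) n) = g" for g
    using shift_solution_iff[OF z, of "?B g" w g] by auto
  have B: "?B g \<in> carrier ell2 \<and> hnorm ell2 (?B g) \<le> C * hnorm ell2 g"
    if g: "g \<in> carrier ell2" for g
  proof -
    have "(\<Sum>k\<le>N. (cmod (?B g k))\<^sup>2) \<le> (C * hnorm ell2 g)\<^sup>2" for N
    proof -
      have "(\<Sum>k\<le>N. (cmod (?B g k))\<^sup>2) \<le> C\<^sup>2 * (\<Sum>k\<le>N. (cmod (g k))\<^sup>2)"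
        using est[of "?B g" N] fun_cong[OF AB[of g]] by simp
      also have "\<dots> \<le> C\<^sup>2 * (hnorm ell2 g)\<^sup>2"
        by (intro mult_left_mono partial_sum_le_hnorm_sq g) auto
      finally show ?thesis by (simp add: power_mult_distrib)
    qed
    moreover have "C * hnorm ell2 g \<ge> 0"
      using C g by (simp add: hnorm_ell2_nonneg)
    ultimately show ?thesis using ell2_bounded_partial_sums by blast
  qed
  have ABc: "?A (?B g) = g" if "g \<in> carrier ell2" for g
    using A B[OF that] AB by auto
  have BA: "?B (?A y) = y" if "y \<in> carrier ell2" for y
    using A[OF that] shift_solution_iff[OF z, of y w "?A y"] by auto
  have "bounded_operator ell2 ?B"
    unfolding bounded_operator_def
  proof (intro conjI ballI allI)
    show "?B \<in> carrier ell2 \<rightarrow> carrier ell2" using B by auto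
    show "\<exists>K. \<forall>x\<in>carrier ell2. hnorm ell2 (?B x) \<le> K * hnorm ell2 x" using B by auto
    fix x y c
    have "z * (?B x n + ?B y n) - weighted_shift w (\<lambda>n. ?B x n + ?B y n) n = x n + y n" for n
      using z by (cases n) (simp_all add: algebra_simps)
    then show "?B (x \<oplus>\<^bsub>ell2\<^esub> y) = ?B x \<oplus>\<^bsub>ell2\<^esub> ?B y"
      unfolding ell2_simps
      by (intro shift_solution_iff[OF z, THEN iffD1, symmetric] allI)
    have "z * (c * ?B x n) - weighted_shift w (\<lambda>n. c * ?B x n) n = c * x n" for n
      using z by (cases n) (simp_all add: algebra_simps)
    then show "?B (c \<odot>\<^bsub>ell2\<^esub> x) = c \<odot>\<^bsub>ell2\<^esub> ?B x"
      unfolding ell2_simps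
      by (intro shift_solution_iff[OF z, THEN iffD1, symmetric] allI)
  qed
  then show "z \<notin> spectrum ell2 (weighted_shift w)"
    unfolding spectrum_def invertible_operator_def using ABc BA by auto
  have res: "resolvent ell2 (weighted_shift w) z g = ?B g" if "g \<in> carrier ell2" for g
  proof -
    have "inj_on ?A (carrier ell2)" using BA by (metis inj_onI)
    then show ?thesis
      unfolding resolvent_def using B[OF that] ABc[OF that] by (metis inv_into_f_f)
  qed
  show "opnorm ell2 (resolvent ell2 (weighted_shift w) z) \<le> C"
    unfolding opnorm_def
  proof (rule cSUP_least)
    show "{x \<in> carrier ell2. hnorm ell2 x \<le> 1} \<noteq> {}"
      using ell2_zero_closed hnorm_ell2[OF ell2_zero_closed] by auto
    fix g assume "g \<in> {x \<in> carrier ell2. hnorm ell2 x \<le> 1}"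
    then have g: "g \<in> carrier ell2" "hnorm ell2 g \<le> 1" by auto
    then show "hnorm ell2 (resolvent ell2 (weighted_shift w) z g) \<le> C"
      using B[OF g(1)] res[OF g(1)] mult_left_mono[OF g(2) C] by simp
  qed
qed

section \<open>An energy estimate from a Riccati inequality\<close>

text \<open>The Riccati inequality says that the quadratic form
  \<open>A a\<^sup>2 - 2 |z| w\<^sub>k a b + B b\<^sup>2\<close> in \<open>a = |y\<^sub>k\<^sub>+\<^sub>1|\<close>, \<open>b = |y\<^sub>k|\<close> has nonpositive discriminant, where
  \<open>A = |z|\<^sup>2 - s\<^sup>2 - p\<^sub>k\<^sub>+\<^sub>1\<close> and \<open>B = w\<^sub>k\<^sup>2 + p\<^sub>k\<close>. Passing to absolute values loses nothing essential,
  as a weighted shift is unitarily equivalent to its rotations; so the bound depends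
  on \<open>|z|\<close> only.\<close>

lemma riccati_energy:
  fixes y :: "nat \<Rightarrow> complex" and p w :: "nat \<Rightarrow> real"
  assumes start: "s\<^sup>2 + p 0 \<le> (cmod z)\<^sup>2"
    and pos: "\<And>k. (w k)\<^sup>2 + p k > 0"
    and w: "\<And>k. w k \<ge> 0"
    and riccati: "\<And>k. (cmod z)\<^sup>2 * (w k)\<^sup>2
      \<le> ((cmod z)\<^sup>2 - s\<^sup>2 - p (Suc k)) * ((w k)\<^sup>2 + p k)"
  shows "s\<^sup>2 * (\<Sum>k\<le>N. (cmod (y k))\<^sup>2) + p N * (cmod (y N))\<^sup>2
    \<le> (\<Sum>k\<le>N. (cmod (z * y k - weighted_shift w y k))\<^sup>2)"
proof (induction N)
  case 0
  show ?case
    using mult_right_mono[OF start, of "(cmod (y 0))\<^sup>2"]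
    by (simp add: norm_mult power_mult_distrib distrib_right)
next
  case (Suc N)
  define a b L where "a = cmod (y (Suc N))" and "b = cmod (y N)" and "L = cmod z"
  define B where "B = (w N)\<^sup>2 + p N"
  define A where "A = L\<^sup>2 - s\<^sup>2 - p (Suc N)"
  have B: "B > 0" using pos[of N] by (simp add: B_def)
  have AB: "L\<^sup>2 * (w N)\<^sup>2 \<le> A * B" using riccati[of N] by (simp add: A_def B_def L_def)
  have "\<bar>L * a - w N * b\<bar> \<le> cmod (z * y (Suc N) - of_real (w N) * y N)"
    using norm_triangle_ineq3[of "z * y (Suc N)" "of_real (w N) * y N"] w[of N]
    by (simp add: norm_mult L_def a_def b_def)
  then have g: "(L * a - w N * b)\<^sup>2 \<le> (cmod (z * y (Suc N) - of_real (w N) * y N))\<^sup>2"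
    by (metis abs_ge_zero power2_abs power_mono)
  \<comment> \<open>Completing the square, after multiplication of the form by \<open>B > 0\<close>.\<close>
  have "0 \<le> (L * w N * a - B * b)\<^sup>2" by simp
  also have "\<dots> = L\<^sup>2 * (w N)\<^sup>2 * a\<^sup>2 - 2 * B * (L * w N * a * b) + B * (B * b\<^sup>2)"
    by (simp add: power2_eq_square algebra_simps)
  also have "\<dots> \<le> A * B * a\<^sup>2 - 2 * B * (L * w N * a * b) + B * (B * b\<^sup>2)"
    using AB by (intro add_right_mono diff_right_mono mult_right_mono) auto
  also have "\<dots> = B * (A * a\<^sup>2 - 2 * (L * w N * a * b) + B * b\<^sup>2)"
    by (simp add: algebra_simps)
  finally have "0 \<le> A * a\<^sup>2 - 2 * (L * w N * a * b) + B * b\<^sup>2"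
    using B by (simp add: zero_le_mult_iff)
  then have "s\<^sup>2 * a\<^sup>2 + p (Suc N) * a\<^sup>2 - p N * b\<^sup>2 \<le> (L * a - w N * b)\<^sup>2"
    by (simp add: A_def B_def power2_eq_square algebra_simps)
  with g Suc show ?case
    by (simp add: a_def b_def distrib_left)
qed

section \<open>A shift with logarithmically growing powers\<close>

text \<open>The norm \<open>\<parallel>T\<^sup>n e\<^sub>0\<parallel>\<^sup>2\<close> up to a constant. The offset 4 keeps the relative increments
  below \<open>1 / (4 (k + 2))\<close> for every \<open>k\<close>, which is what small indices need in \<open>drift_le_excess\<close>.\<close>

definition log_weight :: "nat \<Rightarrow> real" where
  "log_weight k = 4 + ln (real k + 2)"

definition log_shift_weight :: "nat \<Rightarrow> real" where
  "log_shift_weight k = sqrt (log_weight (Suc k) / log_weight k)"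

text \<open>The function \<open>\<epsilon>\<close>. The argument \<open>1 + 1 / x\<close> in place of \<open>1 / x\<close> makes it positive, continuous
  and at most \<open>1/2\<close> on the whole half-line, so that one estimate serves all \<open>|z| > 1\<close>.\<close>

definition excess :: "real \<Rightarrow> real" where
  "excess x = 2 / (2 + ln (1 + 1 / x))\<^sup>2"

lemma log_weight_ge: "log_weight k \<ge> 4"
  by (simp add: log_weight_def)

lemma log_shift_weight_sq: "(log_shift_weight k)\<^sup>2 = log_weight (Suc k) / log_weight k"
  using log_weight_ge[of k] log_weight_ge[of "Suc k"]
  by (simp add: log_shift_weight_def)

lemma log_shift_weight_sq_le:
  "1 \<le> (log_shift_weight k)\<^sup>2"
  "(log_shift_weight k)\<^sup>2 \<le> 1 + 1 / ((real k + 2) * log_weight k)"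
proof -
  have p: "log_weight k > 0" using log_weight_ge[of k] by linarith
  have "log_weight (Suc k) - log_weight k = ln (1 + 1 / (real k + 2))"
  proof -
    have "real k + 3 = (real k + 2) * (1 + 1 / (real k + 2))" by (simp add: field_simps)
    moreover have "1 + 1 / (real k + 2) > 0" by (simp add: add_pos_pos)
    ultimately have "ln (real k + 3) = ln (real k + 2) + ln (1 + 1 / (real k + 2))"
      by (simp only: ln_mult_pos)
    then show ?thesis by (simp add: log_weight_def add.commute)
  qed
  moreover have "\<dots> \<le> 1 / (real k + 2)" by (intro ln_add_one_self_le_self) auto
  ultimately have d: "log_weight (Suc k) \<le> log_weight k + 1 / (real k + 2)" by linarith
  have "log_weight k \<le> log_weight (Suc k)" by (simp add: log_weight_def)
  then show "1 \<le> (log_shift_weight k)\<^sup>2" using p by (simp add: log_shift_weight_sq)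
  have "log_weight (Suc k) / log_weight k \<le> (log_weight k + 1 / (real k + 2)) / log_weight k"
    using d p by (intro divide_right_mono) auto
  also have "\<dots> = 1 + 1 / ((real k + 2) * log_weight k)" using p by (simp add: add_divide_distrib)
  finally show "(log_shift_weight k)\<^sup>2 \<le> 1 + 1 / ((real k + 2) * log_weight k)"
    by (simp add: log_shift_weight_sq)
qed

lemma log_shift_weight_ge_zero: "log_shift_weight k \<ge> 0"
  using log_weight_ge[of k] log_weight_ge[of "Suc k"] by (simp add: log_shift_weight_def)

lemma log_shift_weight_bounded: "\<bar>log_shift_weight k\<bar> \<le> 2"
proof -
  have "1 \<le> (real k + 2) * log_weight k"
    using mult_mono[of 1 "real k + 2" 1 "log_weight k"] log_weight_ge[of k] by simp
  then have "1 / ((real k + 2) * log_weight k) \<le> 1" by (simp add: divide_le_eq)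
  then have "(log_shift_weight k)\<^sup>2 \<le> 2\<^sup>2" using log_shift_weight_sq_le(2)[of k] by simp
  then have "log_shift_weight k \<le> 2" by (rule power2_le_imp_le) simp
  then show ?thesis using log_shift_weight_ge_zero[of k] by simp
qed

lemma excess_bounds:
  assumes "r > 0"
  shows "0 < excess r" "excess r \<le> 1 / 2"
proof -
  have m: "2 + ln (1 + 1 / r) \<ge> 2" using assms by simp
  then have "2\<^sup>2 \<le> (2 + ln (1 + 1 / r))\<^sup>2" by (intro power_mono) auto
  then show "0 < excess r" "excess r \<le> 1 / 2"
    using m by (auto simp: excess_def divide_le_eq)
qed

text \<open>With \<open>x = n r\<close>, \<open>n = k + 2\<close>, this is \<open>n\<^sup>2\<close> times the comparison of the loss \<open>r / (n L(k))\<close>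
  with half of the Hardy gain \<open>1 / (4 n\<^sup>2)\<close> plus \<open>\<epsilon>(r) r\<^sup>2\<close>. For small \<open>x\<close> the bound \<open>L \<ge> 4\<close> suffices.
  Otherwise \<open>n > 1 / (2 r)\<close>, so \<open>L(k)\<close> is at least the logarithm \<open>m\<close> in the definition of
  \<open>\<epsilon>(r) = 2 / m\<^sup>2\<close>.\<close>

lemma drift_le_excess:
  assumes "r > 0"
  shows "real (k + 2) * r / log_weight k \<le> 1 / 8 + excess r * (real (k + 2) * r)\<^sup>2"
proof (cases "real (k + 2) * r \<le> 1 / 2")
  case True
  have "real (k + 2) * r / log_weight k \<le> (1 / 2) / 4"
    using True log_weight_ge[of k] assms by (intro frac_le) auto
  also have "\<dots> \<le> 1 / 8 + excess r * (real (k + 2) * r)\<^sup>2"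
    using excess_bounds[OF assms] by simp
  finally show ?thesis .
next
  case False
  define x m where "x = real (k + 2) * r" and "m = 2 + ln (1 + 1 / r)"
  have x: "x > 1 / 2" using False by (simp add: x_def)
  have m: "m \<ge> 2" using assms by (simp add: m_def)
  have "1 + 1 / r \<le> 3 * (real k + 2)"
  proof -
    have "1 / r < 2 * (real k + 2)" using x assms by (simp add: x_def field_simps)
    also have "\<dots> \<le> 3 * (real k + 2) - 1" by simp
    finally show ?thesis by linarith
  qed
  then have "ln (1 + 1 / r) \<le> ln (3 * (real k + 2))"
    using assms by (simp add: add_pos_pos)
  also have "\<dots> = ln 3 + ln (real k + 2)" by (rule ln_mult_pos) simp_all
  also have "ln (3::real) \<le> 2" using ln_le_minus_one[of "3::real"] by simp
  finally have le: "m \<le> log_weight k" by (simp add: m_def log_weight_def)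
  have perfect_square: "u \<le> 1 / 8 + 2 * u\<^sup>2" for u :: real
  proof -
    have "(4 * u - 1)\<^sup>2 = 16 * u\<^sup>2 - 8 * u + 1"
      by (simp add: power2_eq_square algebra_simps)
    then show ?thesis using zero_le_power2[of "4 * u - 1"] by linarith
  qed
  have "x / log_weight k \<le> x / m" using le m x by (intro divide_left_mono) auto
  also have "x / m \<le> 1 / 8 + 2 * (x / m)\<^sup>2"
    by (rule perfect_square)
  also have "2 * (x / m)\<^sup>2 = excess r * x\<^sup>2"
    by (simp add: excess_def m_def power_divide)
  finally show ?thesis by (simp add: x_def)
qed

text \<open>Write \<open>p\<^sub>k = r + c\<close>, \<open>p\<^sub>k\<^sub>+\<^sub>1 = r + b\<close> and \<open>w\<^sub>k\<^sup>2 = 1 + d\<close>. All terms of the Riccati inequality that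
  do not contain \<open>\<epsilon>\<close>, \<open>b\<close>, \<open>c\<close> or \<open>d\<close> cancel, and up to nonnegative terms it remains to show
  \<open>d (r + b) \<le> \<epsilon> r\<^sup>2 + (c - b - b c)\<close>. The choice \<open>b = 1 / (2 n)\<close>, \<open>c = 1 / (2 (n - 1))\<close> gives
  \<open>c - b - b c\<close> its largest size among multiples of \<open>1/n\<close>, namely about \<open>1 / (4 n\<^sup>2)\<close>, the constant
  of Hardy's inequality.\<close>

lemma log_shift_riccati:
  fixes r :: real
  assumes r: "r > 0"
  defines "p \<equiv> \<lambda>k. r + 1 / (2 * real (Suc k))"
  shows "(1 + r)\<^sup>2 * (log_shift_weight k)\<^sup>2
    \<le> ((1 + r)\<^sup>2 - r\<^sup>2 * (1 - excess r) - p (Suc k)) * ((log_shift_weight k)\<^sup>2 + p k)"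
proof -
  define d e n where "d = (log_shift_weight k)\<^sup>2 - 1" and "e = excess r" and "n = real k + 2"
  define b c where "b = 1 / (2 * n)" and "c = 1 / (2 * (n - 1))"
  have n: "n \<ge> 2" by (simp add: n_def)
  have e: "e > 0" using excess_bounds[OF r] by (simp add: e_def)
  have bc: "b > 0" "c > 0" using n by (auto simp: b_def c_def)
  have d0: "d \<ge> 0" using log_shift_weight_sq_le(1)[of k] by (simp add: d_def)
  have diff: "c - b - b * c = 1 / (4 * (n * (n - 1)))"
    using n by (simp add: b_def c_def field_simps)
  have main: "d * (r + b) \<le> e * r\<^sup>2 + (c - b - b * c)"
  proof -
    define l where "l = log_weight k"
    have l: "l \<ge> 4" using log_weight_ge by (simp add: l_def)
    have "d \<le> 1 / (n * l)"
      using log_shift_weight_sq_le(2)[of k] by (simp add: d_def n_def l_def)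
    then have "d * (r + b) \<le> 1 / (n * l) * (r + b)"
      using r bc by (intro mult_right_mono) auto
    also have "\<dots> = (n * r / l) / n\<^sup>2 + (1 / l) / (2 * n\<^sup>2)"
      using n l by (simp add: b_def power2_eq_square field_simps)
    also have "\<dots> \<le> (1 / 8 + e * (n * r)\<^sup>2) / n\<^sup>2 + (1 / 4) / (2 * n\<^sup>2)"
      using drift_le_excess[OF r, of k] l n
      by (intro add_mono divide_right_mono frac_le) (auto simp: e_def n_def l_def add_ac)
    also have "\<dots> = e * r\<^sup>2 + 1 / (4 * n\<^sup>2)"
      using n by (simp add: field_simps power2_eq_square)
    also have "1 / (4 * n\<^sup>2) \<le> 1 / (4 * (n * (n - 1)))"
      using n by (intro divide_left_mono) (auto simp: power2_eq_square intro!: mult_left_mono)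
    finally show ?thesis by (simp add: diff)
  qed
  have "((1 + r)\<^sup>2 - r\<^sup>2 * (1 - e) - (r + b)) * ((1 + d) + (r + c)) - (1 + r)\<^sup>2 * (1 + d)
      = (1 + r) * (e * r\<^sup>2 + (c - b - b * c) - d * (r + b))
        + (r * (b * c) + e * r\<^sup>2 * c + d * (e * r\<^sup>2) + r * b * d)"
    by (simp add: power2_eq_square algebra_simps)
  moreover have "0 \<le> (1 + r) * (e * r\<^sup>2 + (c - b - b * c) - d * (r + b))"
    using main r by (intro mult_nonneg_nonneg) auto
  moreover have "0 \<le> r * (b * c) + e * r\<^sup>2 * c + d * (e * r\<^sup>2) + r * b * d"
    using r e bc d0 by (intro add_nonneg_nonneg mult_nonneg_nonneg) auto
  ultimately have "(1 + r)\<^sup>2 * (1 + d)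
      \<le> ((1 + r)\<^sup>2 - r\<^sup>2 * (1 - e) - (r + b)) * ((1 + d) + (r + c))"
    by linarith
  moreover have "p (Suc k) = r + b" "p k = r + c"
    by (simp_all add: p_def b_def c_def n_def algebra_simps)
  ultimately show ?thesis by (simp add: d_def e_def)
qed

lemma log_shift_resolvent:
  assumes z: "cmod z > 1"
  defines "r \<equiv> cmod z - 1"
  shows "z \<notin> spectrum ell2 (weighted_shift log_shift_weight)"
    and "opnorm ell2 (resolvent ell2 (weighted_shift log_shift_weight) z) \<le> (1 + excess r) / r"
proof -
  define p where "p = (\<lambda>k. r + 1 / (2 * real (Suc k)))"
  define s where "s = r * sqrt (1 - excess r)"
  define C where "C = (1 + excess r) / r"
  have r: "r > 0" using z by (simp add: r_def)
  have Lz: "cmod z = 1 + r" by (simp add: r_def)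
  note e = excess_bounds[OF r]
  have s: "s\<^sup>2 = r\<^sup>2 * (1 - excess r)"
    using e by (simp add: s_def power_mult_distrib)
  \<comment> \<open>\<open>C = (1 + \<epsilon>) / r\<close> dominates \<open>1 / s\<close>: \<open>(1 + \<epsilon>)\<^sup>2 (1 - \<epsilon>) \<ge> 1\<close> holds for \<open>0 \<le> \<epsilon> \<le> 1/2\<close>.\<close>
  have C1: "1 \<le> C\<^sup>2 * s\<^sup>2"
  proof -
    have "excess r * excess r \<le> excess r * (1 / 2)" using e by (intro mult_left_mono) auto
    then have "0 \<le> 1 - excess r - excess r * excess r" using e by linarith
    then have "0 \<le> excess r * (1 - excess r - excess r * excess r)"
      using e by (intro mult_nonneg_nonneg) auto
    then have "1 \<le> (1 + excess r)\<^sup>2 * (1 - excess r)"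
      by (simp add: power2_eq_square algebra_simps)
    also have "\<dots> = C\<^sup>2 * s\<^sup>2" using r by (simp add: s C_def power_divide)
    finally show ?thesis .
  qed
  have C0: "C \<ge> 0" using r e by (simp add: C_def)
  have p0: "p k > 0" for k using r by (simp add: p_def add_pos_pos)
  have est: "(\<Sum>k\<le>N. (cmod (y k))\<^sup>2)
      \<le> C\<^sup>2 * (\<Sum>k\<le>N. (cmod (z * y k - weighted_shift log_shift_weight y k))\<^sup>2)" for y N
  proof -
    let ?Y = "\<Sum>k\<le>N. (cmod (y k))\<^sup>2"
    let ?G = "\<Sum>k\<le>N. (cmod (z * y k - weighted_shift log_shift_weight y k))\<^sup>2"
    have "s\<^sup>2 * ?Y + p N * (cmod (y N))\<^sup>2 \<le> ?G"
    proof (rule riccati_energy)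
      have "r\<^sup>2 * (1 - excess r) \<le> r\<^sup>2" using e by (intro mult_left_le) auto
      then show "s\<^sup>2 + p 0 \<le> (cmod z)\<^sup>2"
        using r unfolding Lz s by (simp add: p_def power2_eq_square algebra_simps)
      show "(log_shift_weight k)\<^sup>2 + p k > 0" for k using p0[of k] by (simp add: add_nonneg_pos)
      show "(cmod z)\<^sup>2 * (log_shift_weight k)\<^sup>2
          \<le> ((cmod z)\<^sup>2 - s\<^sup>2 - p (Suc k)) * ((log_shift_weight k)\<^sup>2 + p k)" for k
        unfolding Lz s p_def by (rule log_shift_riccati[OF r])
    qed (rule log_shift_weight_ge_zero)
    then have "s\<^sup>2 * ?Y \<le> ?G"
      using p0[of N] by (smt (verit) mult_nonneg_nonneg zero_le_power2)
    then have "C\<^sup>2 * (s\<^sup>2 * ?Y) \<le> C\<^sup>2 * ?G" by (intro mult_left_mono) auto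
    moreover have "1 * ?Y \<le> (C\<^sup>2 * s\<^sup>2) * ?Y"
      by (intro mult_right_mono C1 sum_nonneg) auto
    ultimately show ?thesis by (simp add: mult.assoc)
  qed
  have "z \<noteq> 0" using z by auto
  from weighted_shift_resolvent[of log_shift_weight, OF log_shift_weight_bounded this C0 est]
  show "z \<notin> spectrum ell2 (weighted_shift log_shift_weight)"
    and "opnorm ell2 (resolvent ell2 (weighted_shift log_shift_weight) z) \<le> (1 + excess r) / r"
    by (simp_all add: C_def)
qed

lemma weighted_shift_power_bounded:
  assumes w: "\<And>k. \<bar>w k\<bar> \<le> W" and x: "x \<in> carrier ell2"
  shows "(weighted_shift w ^^ n) x \<in> carrier ell2
    \<and> hnorm ell2 ((weighted_shift w ^^ n) x) \<le> W ^ n * hnorm ell2 x"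
proof (induction n)
  case 0
  then show ?case using x by simp
next
  case (Suc n)
  have "W \<ge> 0" using w[of 0] by linarith
  then have "W * hnorm ell2 ((weighted_shift w ^^ n) x) \<le> W * (W ^ n * hnorm ell2 x)"
    using Suc by (intro mult_left_mono) auto
  moreover from Suc have mem: "(weighted_shift w ^^ n) x \<in> carrier ell2" by blast
  ultimately show ?case
    using weighted_shift_bounded[of w, OF w mem] by (simp add: mult.assoc)
qed

lemma weighted_shift_power_unit:
  "(weighted_shift w ^^ n) (\<lambda>k. if k = 0 then 1 else 0)
    = (\<lambda>k. if k = n then of_real (\<Prod>j<n. w j) else 0)"
proof (induction n)
  case (Suc n)
  have "weighted_shift w (\<lambda>k. if k = n then of_real (\<Prod>j<n. w j) else 0) m
      = (if m = Suc n then of_real (\<Prod>j<Suc n. w j) else 0)" for m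
    by (cases m) auto
  with Suc show ?case by auto
qed auto

text \<open>The powers applied to the first basis vector give products of weights, whose squares telescope
  to \<open>L(n) / L(0)\<close>.\<close>

lemma log_shift_not_power_bounded:
  "\<not> power_bounded ell2 (weighted_shift log_shift_weight)"
proof
  let ?T = "weighted_shift log_shift_weight"
  let ?e = "\<lambda>k. if k = 0 then 1 else 0 :: complex"
  assume "power_bounded ell2 ?T"
  then obtain M where M: "\<And>n. n \<ge> 1 \<Longrightarrow> opnorm ell2 (?T ^^ n) \<le> M"
    by (auto simp: power_bounded_def bdd_above_def)
  have single: "(\<lambda>k. if k = n then c else 0) \<in> carrier ell2"
    "hnorm ell2 (\<lambda>k. if k = n then c else 0) = cmod c" for n c
  proof -
    have eq: "(\<lambda>k. (cmod (if k = n then c else 0))\<^sup>2) = (\<lambda>k. if k = n then (cmod c)\<^sup>2 else 0)"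
      by auto
    have s: "(\<lambda>k. if k = n then (cmod c)\<^sup>2 else 0) sums (cmod c)\<^sup>2"
      by (rule sums_single)
    then show m: "(\<lambda>k. if k = n then c else 0) \<in> carrier ell2"
      by (simp only: ell2_simps(1) eq sums_summable)
    show "hnorm ell2 (\<lambda>k. if k = n then c else 0) = cmod c"
      unfolding hnorm_ell2[OF m] eq sums_unique[OF s, symmetric] by simp
  qed
  have lower: "(\<Prod>j<n. log_shift_weight j) \<le> opnorm ell2 (?T ^^ n)" for n
  proof -
    let ?U = "{x \<in> carrier ell2. hnorm ell2 x \<le> 1}"
    have "bdd_above ((\<lambda>x. hnorm ell2 ((?T ^^ n) x)) ` ?U)"
    proof (rule bdd_aboveI2)
      fix x assume "x \<in> ?U"
      then have x: "x \<in> carrier ell2" "hnorm ell2 x \<le> 1" by auto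
      have "hnorm ell2 ((?T ^^ n) x) \<le> 2 ^ n * hnorm ell2 x"
        using weighted_shift_power_bounded[of log_shift_weight, OF log_shift_weight_bounded x(1)] by blast
      also have "\<dots> \<le> 2 ^ n" using x(2) by simp
      finally show "hnorm ell2 ((?T ^^ n) x) \<le> 2 ^ n" .
    qed
    moreover have "?e \<in> ?U" using single[of 0 1] by simp
    ultimately have "hnorm ell2 ((?T ^^ n) ?e) \<le> opnorm ell2 (?T ^^ n)"
      unfolding opnorm_def by (rule cSUP_upper[rotated])
    moreover have "(\<Prod>j<n. log_shift_weight j) \<ge> 0"
      by (intro prod_nonneg ballI log_shift_weight_ge_zero)
    ultimately show ?thesis unfolding weighted_shift_power_unit single(2) norm_of_real by simp
  qed
  have prod: "(\<Prod>j<n. log_shift_weight j)\<^sup>2 = log_weight n / log_weight 0" for n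
  proof (induction n)
    case 0
    then show ?case using log_weight_ge[of 0] by simp
  next
    case (Suc n)
    then show ?case
      using log_weight_ge[of n] by (simp add: power_mult_distrib log_shift_weight_sq)
  qed
  have bound: "log_weight n \<le> M\<^sup>2 * log_weight 0" if "n \<ge> 1" for n
  proof -
    have "(\<Prod>j<n. log_shift_weight j)\<^sup>2 \<le> M\<^sup>2"
      using order_trans[OF lower M[OF that]]
      by (intro power_mono prod_nonneg ballI log_shift_weight_ge_zero)
    then show ?thesis using log_weight_ge[of 0] by (simp add: prod divide_le_eq)
  qed
  obtain n where n: "real n > exp (M\<^sup>2 * log_weight 0)" using reals_Archimedean2 by blast
  then have "n \<ge> 1" by (cases n) (auto simp: not_less)
  have "M\<^sup>2 * log_weight 0 < ln (real n)"
    using n by (metis exp_gt_zero ln_exp ln_less_cancel_iff order_less_trans)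
  also have "\<dots> \<le> log_weight n"
    using \<open>n \<ge> 1\<close> by (simp add: log_weight_def add_increasing)
  finally show False using bound[OF \<open>n \<ge> 1\<close>] by linarith
qed

lemma excess_tendsto_zero: "(excess \<longlongrightarrow> 0) (at_right 0)"
proof -
  have "filterlim (\<lambda>x::real. 1 / x) at_top (at_right 0)"
    using filterlim_inverse_at_top_right by (simp add: inverse_eq_divide)
  then have "filterlim (\<lambda>x::real. 1 + 1 / x) at_top (at_right 0)"
    by (intro filterlim_tendsto_add_at_top[OF tendsto_const])
  then have "filterlim (\<lambda>x::real. ln (1 + 1 / x)) at_top (at_right 0)"
    by (rule filterlim_compose[OF ln_at_top])
  then have "filterlim (\<lambda>x::real. 2 + ln (1 + 1 / x)) at_top (at_right 0)"
    by (intro filterlim_tendsto_add_at_top[OF tendsto_const])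
  then have "filterlim (\<lambda>x::real. (2 + ln (1 + 1 / x))\<^sup>2) at_top (at_right 0)"
    by (intro filterlim_pow_at_top) auto
  then have "((\<lambda>x::real. 2 / (2 + ln (1 + 1 / x))\<^sup>2) \<longlongrightarrow> 0) (at_right 0)"
    by (intro tendsto_divide_0[OF tendsto_const] filterlim_at_top_imp_at_infinity)
  then show ?thesis by (simp add: excess_def[abs_def])
qed

lemma excess_continuous: "continuous_on {0<..<\<nu>} excess"
proof -
  have "1 + 1 / x > 0 \<and> 2 + ln (1 + 1 / x) \<noteq> 0" if "x \<in> {0<..<\<nu>}" for x :: real
  proof -
    have "1 / x > 0" using that by simp
    then have "ln (1 + 1 / x) \<ge> 0" by (intro ln_ge_zero) linarith
    with \<open>1 / x > 0\<close> show ?thesis by (intro conjI; linarith)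
  qed
  then show ?thesis
    unfolding excess_def[abs_def] by (intro continuous_intros) fastforce+
qed

theorem theorem5p1:
  shows "\<exists>(H :: (nat \<Rightarrow> complex) hilbert) (T :: (nat \<Rightarrow> complex) \<Rightarrow> nat \<Rightarrow> complex)
            (\<nu> :: real) (\<epsilon> :: real \<Rightarrow> real).
           complex_hilbert_space H \<and>
           bounded_operator H T \<and>
           spectrum H T \<subseteq> cball 0 1 \<and>
           \<nu> > 0 \<and>
           continuous_on {0<..<\<nu>} \<epsilon> \<and>
           \<epsilon> \<in> {0<..<\<nu>} \<rightarrow> {0..} \<and>
           (\<epsilon> \<longlongrightarrow> 0) (at_right 0) \<and>
           (\<forall>z::complex. 1 < norm z \<and> norm z < 1 + \<nu> \<longrightarrow>
              opnorm H (resolvent H T z) \<le> (1 + \<epsilon> (norm z - 1)) / (norm z - 1)) \<and>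
           \<not> power_bounded H T"
proof (intro exI conjI)
  let ?T = "weighted_shift log_shift_weight"
  show "complex_hilbert_space ell2" by (rule complex_hilbert_space_ell2)
  show "bounded_operator ell2 ?T"
    by (rule bounded_operator_weighted_shift[of log_shift_weight, OF log_shift_weight_bounded])
  show "spectrum ell2 ?T \<subseteq> cball 0 1"
    using log_shift_resolvent(1) by (force simp: not_le[symmetric])
  show "(1::real) > 0" by simp
  show "continuous_on {0<..<1} excess" by (rule excess_continuous)
  show "excess \<in> {0<..<1} \<rightarrow> {0..}" using excess_bounds(1) by (force intro: less_imp_le)
  show "(excess \<longlongrightarrow> 0) (at_right 0)" by (rule excess_tendsto_zero)
  show "\<forall>z::complex. 1 < norm z \<and> norm z < 1 + 1 \<longrightarrow>
      opnorm ell2 (resolvent ell2 ?T z) \<le> (1 + excess (norm z - 1)) / (norm z - 1)"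
    using log_shift_resolvent(2) by blast
  show "\<not> power_bounded ell2 ?T" by (rule log_shift_not_power_bounded)
qed

end
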